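(* Let $n$, $d$ and $k$ be positive integers such that $d\ge 3$ (and $d\le n/2$). If $C$ is an identifying code in $C_n(1,d-1,d)$ with $k$ codewords, then there exists an identifying code in the infinite triangular grid $\mathcal{T}$ with density $k/n$. Analogously, a locating-dominating (respectively self-identifying) code in $C_n(1,d-1,d)$ with $k$ codewords yields a locating-dominating (respectively self-identifying) code in $\mathcal{T}$ with density $k/n$.
   Context: All graphs are simple and undirected. For a graph $G=(V,E)$ and $u\in V$, $N[u]=\{u\}\cup\{v: uv\in E\}$. A code is a nonempty $C\subseteq V$, and $I(C;u)=N[u]\cap C$. $C$ is dominating if $I(C;u)\neq\emptyset$ for all $u$; identifying if dominating and $I(C;u)\neq I(C;v)$ for all distinct $u,v\in V$; locating-dominating if dominating and $I(C;u)\neq I(C;v)$ for all distinct $u,v\in V\setminus C$; self-identifying if $I(C;u)\setminus I(C;v)\neq\emptyset$ for all distinct $u,v\in V$. For positive integers $n$ and $d_1,\dots,d_k\le n/2$, the circulant graph $C_n(d_1,\dots,d_k)$ has vertex set $\mathbb{Z}_n$, and the open neighbourhood of $u$ is $\{u\pm d_1,\dots,u\pm d_k\}$ modulo $n$. The infinite triangular grid $\mathcal{T}$ has vertex set $\mathbb{Z}^2$ and $N[(x,y)]=\{(x',y'): |x-x'|+|y-y'|\le1\}\cup\{(x+1,y+1),(x-1,y-1)\}$. With $Q_m=\{(x,y)\in\mathbb{Z}^2:|x|\le m,|y|\le m\}$, the density of $C\subseteq\mathbb{Z}^2$ is $\limsup_{m\to\infty}|C\cap Q_m|/|Q_m|$.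 *)

theory Defs
  imports Complex_Main "HOL-Library.Extended_Real"
begin

record 'a ugraph =
  verts :: "'a set"
  edges :: "'a set set"

definition simple_graph :: "'a ugraph \<Rightarrow> bool" where
  "simple_graph G \<longleftrightarrow> (\<forall>e\<in>edges G. e \<subseteq> verts G \<and> card e = 2)"

definition open_nbhd :: "'a ugraph \<Rightarrow> 'a \<Rightarrow> 'a set" where
  "open_nbhd G u = {v. {u, v} \<in> edges G}"

definition closed_nbhd :: "'a ugraph \<Rightarrow> 'a \<Rightarrow> 'a set" where
  "closed_nbhd G u = {u} \<union> open_nbhd G u"

definition code :: "'a ugraph \<Rightarrow> 'a set \<Rightarrow> bool" where
  "code G C \<longleftrightarrow> C \<noteq> {} \<and> C \<subseteq> verts G"

definition I_set :: "'a ugraph \<Rightarrow> 'a set \<Rightarrow> 'a \<Rightarrow> 'a set" where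
  "I_set G C u = closed_nbhd G u \<inter> C"

definition dominating_code :: "'a ugraph \<Rightarrow> 'a set \<Rightarrow> bool" where
  "dominating_code G C \<longleftrightarrow> code G C \<and> (\<forall>u\<in>verts G. I_set G C u \<noteq> {})"

definition identifying_code :: "'a ugraph \<Rightarrow> 'a set \<Rightarrow> bool" where
  "identifying_code G C \<longleftrightarrow> dominating_code G C \<and>
     (\<forall>u\<in>verts G. \<forall>v\<in>verts G. u \<noteq> v \<longrightarrow> I_set G C u \<noteq> I_set G C v)"

definition locating_dominating_code :: "'a ugraph \<Rightarrow> 'a set \<Rightarrow> bool" where
  "locating_dominating_code G C \<longleftrightarrow> dominating_code G C \<and>
     (\<forall>u\<in>verts G - C. \<forall>v\<in>verts G - C. u \<noteq> v \<longrightarrow> I_set G C u \<noteq> I_set G C v)"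

definition self_identifying_code :: "'a ugraph \<Rightarrow> 'a set \<Rightarrow> bool" where
  "self_identifying_code G C \<longleftrightarrow> code G C \<and>
     (\<forall>u\<in>verts G. \<forall>v\<in>verts G. u \<noteq> v \<longrightarrow> I_set G C u - I_set G C v \<noteq> {})"

text \<open>
  The group of integers modulo \<open>n\<close> is represented by the residues \<open>0, \<dots>, n - 1\<close>.  The
  definition of the circulant graph is meant for sets \<open>D\<close> of positive integers that are
  at most \<open>n / 2\<close>: it is then a simple graph (\<open>simple_graph_circulant\<close>) with the intended
  open neighbourhoods (\<open>open_nbhd_circulant\<close>).
\<close>

definition circulant_graph :: "nat \<Rightarrow> nat set \<Rightarrow> int ugraph" where
  "circulant_graph n D =
     \<lparr> verts = {0..<int n},
       edges = {{u, v} | u v. u \<in> {0..<int n} \<and>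
         (\<exists>d\<in>D. v = (u + int d) mod int n \<or> v = (u - int d) mod int n)} \<rparr>"

lemma circulant_shift_neq:
  assumes "0 < d" "2 * d \<le> n" "0 \<le> u" "u < int n"
  shows "(u + int d) mod int n \<noteq> u" "(u - int d) mod int n \<noteq> u"
proof -
  have nd: "\<not> int n dvd int d"
    using assms zdvd_imp_le[of "int n" "int d"] by auto
  have u: "u = u mod int n"
    using assms by simp
  show "(u + int d) mod int n \<noteq> u"
  proof
    assume "(u + int d) mod int n = u"
    then have "(u + int d) mod int n = u mod int n" using u by simp
    then have "int n dvd (u + int d) - u" by (simp only: mod_eq_dvd_iff)
    then show False using nd by simp
  qed
  show "(u - int d) mod int n \<noteq> u"
  proof
    assume "(u - int d) mod int n = u"
    then have "(u - int d) mod int n = u mod int n" using u by simp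
    then have "int n dvd (u - int d) - u" by (simp only: mod_eq_dvd_iff)
    then show False using nd by simp
  qed
qed

lemma simple_graph_circulant:
  assumes "\<forall>d\<in>D. 0 < d \<and> 2 * d \<le> n"
  shows "simple_graph (circulant_graph n D)"
proof -
  have "{u, v} \<subseteq> {0..<int n} \<and> card {u, v} = 2"
    if u: "u \<in> {0..<int n}" and d: "d \<in> D"
      and v: "v = (u + int d) mod int n \<or> v = (u - int d) mod int n" for u v d
  proof -
    have "v \<noteq> u"
      using circulant_shift_neq[of d n u] assms u d v by auto
    moreover have "v \<in> {0..<int n}"
      using u v by auto
    ultimately show ?thesis using u by auto
  qed
  then show ?thesis
    unfolding simple_graph_def circulant_graph_def ugraph.simps by blast
qed

lemma open_nbhd_circulant:
  assumes "u \<in> {0..<int n}"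
  shows "open_nbhd (circulant_graph n D) u =
    (\<Union>d\<in>D. {(u + int d) mod int n, (u - int d) mod int n})"
proof -
  have 1: "u = (v - int d) mod int n" if "v = (u + int d) mod int n" for v d
    using assms that by (simp add: mod_simps)
  have 2: "u = (v + int d) mod int n" if "v = (u - int d) mod int n" for v d
    using assms that by (simp add: mod_simps)
  have 3: "v = (u + int d) mod int n"
    if "u = (v - int d) mod int n" "v \<in> {0..<int n}" for v d
    using that by (simp add: mod_simps)
  have 4: "v = (u - int d) mod int n"
    if "u = (v + int d) mod int n" "v \<in> {0..<int n}" for v d
    using that by (simp add: mod_simps)
  show ?thesis
  proof (intro set_eqI iffI)
    fix w assume "w \<in> open_nbhd (circulant_graph n D) u"
    then obtain a b d where ab: "{u, w} = {a, b}" "a \<in> {0..<int n}" "d \<in> D"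
        "b = (a + int d) mod int n \<or> b = (a - int d) mod int n"
      by (auto simp: open_nbhd_def circulant_graph_def)
    then consider "u = a" "w = b" | "u = b" "w = a"
      by (auto simp: doubleton_eq_iff)
    then have "w = (u + int d) mod int n \<or> w = (u - int d) mod int n"
    proof cases
      case 1 then show ?thesis using ab by blast
    next
      case 2 then show ?thesis using ab 3[of w d] 4[of w d] by blast
    qed
    then show "w \<in> (\<Union>d\<in>D. {(u + int d) mod int n, (u - int d) mod int n})"
      using ab by blast
  next
    fix w assume "w \<in> (\<Union>d\<in>D. {(u + int d) mod int n, (u - int d) mod int n})"
    then show "w \<in> open_nbhd (circulant_graph n D) u"
      using assms unfolding open_nbhd_def circulant_graph_def by auto
  qed
qed

definition triangular_ball :: "int \<times> int \<Rightarrow> (int \<times> int) set" where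
  "triangular_ball = (\<lambda>(x, y).
     {(x', y'). \<bar>x - x'\<bar> + \<bar>y - y'\<bar> \<le> 1} \<union> {(x + 1, y + 1), (x - 1, y - 1)})"

definition triangular_grid :: "(int \<times> int) ugraph" where
  "triangular_grid =
     \<lparr> verts = UNIV, edges = {{p, q} | p q. p \<noteq> q \<and> q \<in> triangular_ball p} \<rparr>"

lemma triangular_ball_sym: "q \<in> triangular_ball p \<longleftrightarrow> p \<in> triangular_ball q"
proof -
  obtain x y x' y' where pq: "p = (x, y)" "q = (x', y')"
    by (cases p, cases q) blast
  have "\<bar>x - x'\<bar> = \<bar>x' - x\<bar>" "\<bar>y - y'\<bar> = \<bar>y' - y\<bar>"
    by (simp_all only: abs_minus_commute)
  moreover have "x' = x + 1 \<longleftrightarrow> x = x' - 1" "y' = y + 1 \<longleftrightarrow> y = y' - 1"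
      "x' = x - 1 \<longleftrightarrow> x = x' + 1" "y' = y - 1 \<longleftrightarrow> y = y' + 1"
    by linarith+
  ultimately show ?thesis
    unfolding pq triangular_ball_def prod.case Un_iff mem_Collect_eq insert_iff empty_iff
      prod.inject by metis
qed

lemma simple_graph_triangular_grid: "simple_graph triangular_grid"
  by (auto simp: simple_graph_def triangular_grid_def)

lemma closed_nbhd_triangular_grid: "closed_nbhd triangular_grid p = triangular_ball p"
proof -
  have "p \<in> triangular_ball p"
    by (cases p) (simp add: triangular_ball_def)
  moreover have "{p, q} \<in> edges triangular_grid \<longleftrightarrow> p \<noteq> q \<and> q \<in> triangular_ball p" for q
    unfolding triangular_grid_def ugraph.simps mem_Collect_eq doubleton_eq_iff
    using triangular_ball_sym by blast
  ultimately show ?thesis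
    unfolding closed_nbhd_def open_nbhd_def by blast
qed

definition Q_box :: "nat \<Rightarrow> (int \<times> int) set" where
  "Q_box m = {(x, y). \<bar>x\<bar> \<le> int m \<and> \<bar>y\<bar> \<le> int m}"

text \<open>The density is taken in \<^typ>\<open>ereal\<close>, where every limit superior exists.\<close>

definition grid_density :: "(int \<times> int) set \<Rightarrow> ereal" where
  "grid_density C =
     limsup (\<lambda>m. ereal (real (card (C \<inter> Q_box m)) / real (card (Q_box m))))"

end

theory Submission
  imports Defs "HOL-Library.Product_Plus"
begin

text \<open>
  With \<open>c = d - 1\<close>, the linear form \<open>x + c y\<close>, taken modulo \<open>n\<close>, sends the seven steps from a
  point of the grid to its closed neighbourhood onto \<open>0, \<plusminus>1, \<plusminus>c, \<plusminus>(c + 1)\<close>. So it maps closed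
  neighbourhoods onto closed neighbourhoods, and the preimage of a code separates points with
  different images as well as the code does. Points of the same fibre are separated for a metric
  reason: two distinct steps from them to a common neighbour \<open>r\<close> have distinct values of the form
  that are congruent modulo \<open>n\<close> and at most \<open>c + 1 \<le> n / 2\<close> in absolute value. Hence \<open>n = 2d\<close>, and
  the steps are \<open>s\<close> and \<open>- s\<close> with \<open>s = \<plusminus>(1, 1)\<close>. The point on the other side of \<open>p = r - s\<close> is then
  in the fibre of \<open>r\<close> and is a neighbour of \<open>p\<close> but not of \<open>r + s\<close>. The density is that of the
  code because the preimage meets any \<open>n\<close> consecutive points of a row in exactly \<open>k\<close> points.
\<close>

section \<open>Lifting codes along projections\<close>

lemma mem_closed_nbhd_self: "u \<in> closed_nbhd G u"
  by (simp add: closed_nbhd_def)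

lemma closed_nbhd_subset_verts:
  assumes "simple_graph G" "u \<in> verts G"
  shows "closed_nbhd G u \<subseteq> verts G"
  using assms by (auto simp: simple_graph_def closed_nbhd_def open_nbhd_def)

lemma self_identifying_imp_dominating_code:
  assumes "self_identifying_code G C"
  shows "dominating_code G C"
proof -
  have C: "C \<noteq> {}" "C \<subseteq> verts G"
    using assms by (auto simp: self_identifying_code_def code_def)
  have "I_set G C u \<noteq> {}" if u: "u \<in> verts G" for u
  proof (cases "verts G = {u}")
    case True
    then show ?thesis
      using C mem_closed_nbhd_self[of u G] by (auto simp: I_set_def)
  next
    case False
    then show ?thesis
      using assms u by (auto simp: self_identifying_code_def)
  qed
  then show ?thesis
    using C by (simp add: dominating_code_def code_def)
qed

locale nbhd_projection =
  fixes G :: "'a ugraph" and H :: "'b ugraph" and f :: "'a \<Rightarrow> 'b"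
  assumes simple_graph: "simple_graph G"
    and image_verts: "f ` verts G = verts H"
    and image_closed_nbhd: "p \<in> verts G \<Longrightarrow> f ` closed_nbhd G p = closed_nbhd H (f p)"
begin

definition lift :: "'b set \<Rightarrow> 'a set" where
  "lift C = {p \<in> verts G. f p \<in> C}"

lemma f_mem_verts: "p \<in> verts G \<Longrightarrow> f p \<in> verts H"
  using image_verts by blast

lemma image_I_set_lift:
  assumes "p \<in> verts G"
  shows "f ` I_set G (lift C) p = I_set H C (f p)"
proof -
  have "I_set G (lift C) p = {r \<in> closed_nbhd G p. f r \<in> C}"
    using closed_nbhd_subset_verts[OF simple_graph assms] by (auto simp: I_set_def lift_def)
  then show ?thesis
    by (auto simp: I_set_def image_closed_nbhd[OF assms, symmetric])
qed

lemma dominating_code_lift: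
  assumes "dominating_code H C"
  shows "dominating_code G (lift C)"
proof -
  have "C \<noteq> {}" "C \<subseteq> f ` verts G"
    using assms image_verts by (simp_all add: dominating_code_def code_def)
  then have "lift C \<noteq> {}"
    by (auto simp: lift_def)
  moreover have "I_set G (lift C) p \<noteq> {}" if "p \<in> verts G" for p
    using assms f_mem_verts[OF that] image_I_set_lift[OF that, of C]
    by (auto simp: dominating_code_def)
  ultimately show ?thesis
    by (auto simp: dominating_code_def code_def lift_def)
qed

end

locale separating_nbhd_projection = nbhd_projection +
  assumes fibre_separation:
    "\<lbrakk>p \<in> verts G; q \<in> verts G; p \<noteq> q; f p = f q; r \<in> closed_nbhd G p; r \<in> closed_nbhd G q\<rbrakk>
      \<Longrightarrow> \<exists>r' \<in> closed_nbhd G p - closed_nbhd G q. f r' = f r"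
begin

lemma I_set_lift_diff_fibre:
  assumes "dominating_code H C" "p \<in> verts G" "q \<in> verts G" "p \<noteq> q" "f p = f q"
  shows "I_set G (lift C) p - I_set G (lift C) q \<noteq> {}"
proof -
  obtain r where r: "r \<in> closed_nbhd G p" "f r \<in> C"
    using dominating_code_lift[OF assms(1)] assms(2)
    by (auto simp: dominating_code_def I_set_def lift_def)
  obtain r' where "r' \<in> closed_nbhd G p - closed_nbhd G q" "f r' = f r"
    using fibre_separation[OF assms(2-5) r(1)] r(1) that by (cases "r \<in> closed_nbhd G q") blast+
  then show ?thesis
    using r(2) closed_nbhd_subset_verts[OF simple_graph assms(2)] by (auto simp: I_set_def lift_def)
qed

lemma I_set_lift_diff:
  assumes "dominating_code H C" "p \<in> verts G" "q \<in> verts G" "p \<noteq> q"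
    and "f p \<noteq> f q \<Longrightarrow> I_set H C (f p) - I_set H C (f q) \<noteq> {}"
  shows "I_set G (lift C) p - I_set G (lift C) q \<noteq> {}"
proof (cases "f p = f q")
  case True
  then show ?thesis
    using I_set_lift_diff_fibre[OF assms(1-4)] by blast
next
  case False
  then have "f ` I_set G (lift C) p - f ` I_set G (lift C) q \<noteq> {}"
    using assms(2,3,5) by (simp only: image_I_set_lift not_False_eq_True)
  then show ?thesis by blast
qed

lemma I_set_lift_neq:
  assumes "dominating_code H C" "p \<in> verts G" "q \<in> verts G" "p \<noteq> q"
    and "f p \<noteq> f q \<Longrightarrow> I_set H C (f p) \<noteq> I_set H C (f q)"
  shows "I_set G (lift C) p \<noteq> I_set G (lift C) q"
proof (cases "f p = f q")
  case True
  then show ?thesis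
    using I_set_lift_diff_fibre[OF assms(1-4)] by blast
next
  case False
  then have "f ` I_set G (lift C) p \<noteq> f ` I_set G (lift C) q"
    using assms(2,3,5) by (simp only: image_I_set_lift not_False_eq_True)
  then show ?thesis by blast
qed

lemma identifying_code_lift:
  assumes "identifying_code H C"
  shows "identifying_code G (lift C)"
proof -
  have "dominating_code H C"
    using assms by (simp add: identifying_code_def)
  moreover have "I_set H C (f p) \<noteq> I_set H C (f q)"
    if "p \<in> verts G" "q \<in> verts G" "f p \<noteq> f q" for p q
    using assms that f_mem_verts by (auto simp: identifying_code_def)
  ultimately show ?thesis
    by (simp add: identifying_code_def dominating_code_lift I_set_lift_neq)
qed

lemma locating_dominating_code_lift:
  assumes "locating_dominating_code H C"
  shows "locating_dominating_code G (lift C)"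
proof -
  have "dominating_code H C"
    using assms by (simp add: locating_dominating_code_def)
  moreover have "I_set H C (f p) \<noteq> I_set H C (f q)"
    if "p \<in> verts G - lift C" "q \<in> verts G - lift C" "f p \<noteq> f q" for p q
    using assms that f_mem_verts by (auto simp: locating_dominating_code_def lift_def)
  ultimately show ?thesis
    by (simp add: locating_dominating_code_def dominating_code_lift I_set_lift_neq)
qed

lemma self_identifying_code_lift:
  assumes "self_identifying_code H C"
  shows "self_identifying_code G (lift C)"
proof -
  have dominating: "dominating_code H C"
    using assms by (rule self_identifying_imp_dominating_code)
  have "I_set G (lift C) p - I_set G (lift C) q \<noteq> {}"
    if "p \<in> verts G" "q \<in> verts G" "p \<noteq> q" for p q
  proof (rule I_set_lift_diff[OF dominating that])
    show "I_set H C (f p) - I_set H C (f q) \<noteq> {}" if "f p \<noteq> f q"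
      using assms that f_mem_verts \<open>p \<in> verts G\<close> \<open>q \<in> verts G\<close>
      by (simp only: self_identifying_code_def) blast
  qed
  then show ?thesis
    using dominating_code_lift[OF dominating]
    by (simp add: self_identifying_code_def dominating_code_def)
qed

end

section \<open>The projection of the triangular grid onto a circulant graph\<close>

lemma verts_circulant_graph: "verts (circulant_graph n D) = {0..<int n}"
  by (simp add: circulant_graph_def)

lemma verts_triangular_grid: "verts triangular_grid = UNIV"
  by (simp add: triangular_grid_def)

definition triangular_steps :: "(int \<times> int) set" where
  "triangular_steps = {(0, 0), (1, 0), (-1, 0), (0, 1), (0, -1), (1, 1), (-1, -1)}"

lemma closed_nbhd_triangular_grid_eq_steps:
  "closed_nbhd triangular_grid p = (\<lambda>s. p + s) ` triangular_steps"
proof (cases p)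
  case (Pair x y)
  have "\<bar>x - x'\<bar> + \<bar>y - y'\<bar> \<le> 1 \<longleftrightarrow>
      (x', y') \<in> {(x, y), (x + 1, y), (x - 1, y), (x, y + 1), (x, y - 1)}" for x' y'
    unfolding insert_iff empty_iff prod.inject by arith
  then show ?thesis
    unfolding closed_nbhd_triangular_grid triangular_ball_def triangular_steps_def Pair by auto
qed

lemma mem_closed_nbhd_triangular_grid_iff:
  "q \<in> closed_nbhd triangular_grid p \<longleftrightarrow> q - p \<in> triangular_steps"
  unfolding closed_nbhd_triangular_grid_eq_steps by (force simp: image_iff algebra_simps)

definition grid_form :: "int \<Rightarrow> int \<times> int \<Rightarrow> int" where
  "grid_form c p = fst p + c * snd p"

lemma grid_form_add: "grid_form c (p + q) = grid_form c p + grid_form c q"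
  by (simp add: grid_form_def algebra_simps)

lemma grid_form_diff: "grid_form c (p - q) = grid_form c p - grid_form c q"
  by (simp add: grid_form_def algebra_simps)

lemma image_grid_form_triangular_steps:
  "grid_form c ` triangular_steps = {0, 1, -1, c, -c, c + 1, -(c + 1)}"
  by (simp add: triangular_steps_def grid_form_def algebra_simps)

lemma inj_on_grid_form_triangular_steps:
  assumes "2 \<le> c"
  shows "inj_on (grid_form c) triangular_steps"
  using assms by (auto simp: inj_on_def triangular_steps_def grid_form_def)

lemma abs_grid_form_triangular_step_le:
  assumes "0 \<le> c" "s \<in> triangular_steps"
  shows "\<bar>grid_form c s\<bar> \<le> c + 1"
  using assms by (auto simp: triangular_steps_def grid_form_def)

lemma congruent_triangular_steps_antipodal:
  assumes "2 \<le> c" "2 * (c + 1) \<le> n"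
    and s: "s \<in> triangular_steps" and t: "t \<in> triangular_steps" and "s \<noteq> t"
    and congruent: "n dvd grid_form c s - grid_form c t"
  shows "s \<in> {(1, 1), (-1, -1)}" and "t = - s" and "n = 2 * (c + 1)"
proof -
  have distinct: "grid_form c s \<noteq> grid_form c t"
    using inj_on_grid_form_triangular_steps[OF assms(1)] s t \<open>s \<noteq> t\<close> by (auto dest: inj_onD)
  then have "n \<le> \<bar>grid_form c s - grid_form c t\<bar>"
    using dvd_imp_le_int[OF _ congruent] by simp
  also have "\<dots> \<le> \<bar>grid_form c s\<bar> + \<bar>grid_form c t\<bar>"
    by (rule abs_triangle_ineq4)
  finally have "n \<le> \<bar>grid_form c s\<bar> + \<bar>grid_form c t\<bar>" .
  moreover have "\<bar>grid_form c s\<bar> \<le> c + 1" "\<bar>grid_form c t\<bar> \<le> c + 1"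
    using abs_grid_form_triangular_step_le assms(1) s t by auto
  ultimately have extreme: "n = 2 * (c + 1)" "\<bar>grid_form c s\<bar> = c + 1" "\<bar>grid_form c t\<bar> = c + 1"
    using assms(2) by simp_all
  then have opposite: "grid_form c t = - grid_form c s"
    using distinct by (auto simp: abs_eq_iff)
  show "n = 2 * (c + 1)"
    by (fact extreme)
  show "s \<in> {(1, 1), (-1, -1)}"
    using s extreme(2) assms(1) by (auto simp: triangular_steps_def grid_form_def)
  then show "t = - s"
    using t opposite assms(1) by (auto simp: triangular_steps_def grid_form_def)
qed

definition grid_residue :: "nat \<Rightarrow> nat \<Rightarrow> int \<times> int \<Rightarrow> int" where
  "grid_residue n c p = grid_form (int c) p mod int n"

lemma grid_residue_eq_iff:
  "grid_residue n c p = grid_residue n c q \<longleftrightarrow> int n dvd grid_form (int c) (p - q)"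
  by (simp add: grid_residue_def grid_form_diff mod_eq_dvd_iff)

lemma range_grid_residue:
  assumes "0 < n"
  shows "range (grid_residue n c) = {0..<int n}"
proof
  show "range (grid_residue n c) \<subseteq> {0..<int n}"
    using assms by (auto simp: grid_residue_def)
  have "u = grid_residue n c (u, 0)" if "u \<in> {0..<int n}" for u
    using that by (simp add: grid_residue_def grid_form_def)
  then show "{0..<int n} \<subseteq> range (grid_residue n c)"
    by blast
qed

lemma image_grid_residue_closed_nbhd:
  assumes "0 < n"
  shows "grid_residue n c ` closed_nbhd triangular_grid p =
    closed_nbhd (circulant_graph n {1, c, Suc c}) (grid_residue n c p)"
proof -
  let ?u = "grid_residue n c p"
  have u: "?u \<in> {0..<int n}"
    using assms range_grid_residue by blast
  have "grid_residue n c ` closed_nbhd triangular_grid p =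
      (\<lambda>w. (?u + w) mod int n) ` grid_form (int c) ` triangular_steps"
    by (simp add: closed_nbhd_triangular_grid_eq_steps image_image grid_residue_def grid_form_add
        mod_simps)
  also have "\<dots> = {?u} \<union> (\<Union>d\<in>{1, c, Suc c}. {(?u + int d) mod int n, (?u - int d) mod int n})"
    using u unfolding image_grid_form_triangular_steps by (auto simp: algebra_simps)
  also have "\<dots> = closed_nbhd (circulant_graph n {1, c, Suc c}) ?u"
    by (simp only: closed_nbhd_def open_nbhd_circulant[OF u])
  finally show ?thesis .
qed

lemma grid_residue_fibre_separation:
  assumes c: "2 \<le> c" "2 * Suc c \<le> n"
    and "p \<noteq> q" "grid_residue n c p = grid_residue n c q"
    and r: "r \<in> closed_nbhd triangular_grid p" "r \<in> closed_nbhd triangular_grid q"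
  shows "\<exists>r' \<in> closed_nbhd triangular_grid p - closed_nbhd triangular_grid q.
    grid_residue n c r' = grid_residue n c r"
proof -
  define s where "s = r - p"
  have steps: "s \<in> triangular_steps" "r - q \<in> triangular_steps"
    using r by (simp_all add: s_def mem_closed_nbhd_triangular_grid_iff)
  have "int n dvd grid_form (int c) s - grid_form (int c) (r - q)"
    using assms(4) unfolding s_def grid_residue_eq_iff
    by (simp add: grid_form_diff dvd_diff_commute)
  moreover have "s \<noteq> r - q"
    using assms(3) by (simp add: s_def)
  ultimately have s: "s \<in> {(1, 1), (-1, -1)}" and antipodal: "r - q = - s"
    and n: "int n = 2 * (int c + 1)"
    using congruent_triangular_steps_antipodal[OF _ _ steps, of "int c" "int n"] c by simp_all
  have "p - s \<in> closed_nbhd triangular_grid p"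
    using s by (auto simp: mem_closed_nbhd_triangular_grid_iff triangular_steps_def)
  moreover have "p - s \<notin> closed_nbhd triangular_grid q"
  proof -
    have "p - s - q = - s - s - s"
      using antipodal by (simp add: s_def algebra_simps)
    then show ?thesis
      unfolding mem_closed_nbhd_triangular_grid_iff
      using s by (auto simp only: triangular_steps_def) simp_all
  qed
  moreover have "grid_residue n c (p - s) = grid_residue n c r"
  proof -
    have "grid_form (int c) (p - s - r) = - grid_form (int c) s - grid_form (int c) s"
      by (simp add: s_def grid_form_diff)
    also have "\<dots> \<in> {int n, - int n}"
      using s n by (auto simp: grid_form_def)
    finally show ?thesis
      unfolding grid_residue_eq_iff by auto
  qed
  ultimately show ?thesis by blast
qed

lemma separating_nbhd_projection_grid_residue:
  assumes "2 \<le> c" "2 * Suc c \<le> n"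
  shows "separating_nbhd_projection triangular_grid (circulant_graph n {1, c, Suc c})
    (grid_residue n c)"
proof unfold_locales
  show "simple_graph triangular_grid"
    by (fact simple_graph_triangular_grid)
  have "0 < n"
    using assms by simp
  then show "grid_residue n c ` verts triangular_grid = verts (circulant_graph n {1, c, Suc c})"
    by (simp only: verts_triangular_grid verts_circulant_graph range_grid_residue)
  show "grid_residue n c ` closed_nbhd triangular_grid p =
      closed_nbhd (circulant_graph n {1, c, Suc c}) (grid_residue n c p)" for p
    using \<open>0 < n\<close> by (rule image_grid_residue_closed_nbhd)
  fix p q r
  assume "p \<noteq> q" "grid_residue n c p = grid_residue n c q"
    "r \<in> closed_nbhd triangular_grid p" "r \<in> closed_nbhd triangular_grid q"
  then show "\<exists>r' \<in> closed_nbhd triangular_grid p - closed_nbhd triangular_grid q.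
      grid_residue n c r' = grid_residue n c r"
    by (rule grid_residue_fibre_separation[OF assms])
qed

section \<open>Densities of sets with periodic rows\<close>

definition grid_row :: "(int \<times> int) set \<Rightarrow> int \<Rightarrow> int set" where
  "grid_row S y = {x. (x, y) \<in> S}"

lemma Q_box_eq: "Q_box m = {- int m..int m} \<times> {- int m..int m}"
  by (auto simp: Q_box_def)

lemma card_Q_box: "card (Q_box m) = (2 * m + 1) * (2 * m + 1)"
  by (simp add: Q_box_eq card_cartesian_product nat_add_distrib nat_mult_distrib)

lemma card_Int_Q_box:
  "card (S \<inter> Q_box m) = (\<Sum>y = - int m..int m. card (grid_row S y \<inter> {- int m..int m}))"
proof -
  have "S \<inter> Q_box m =
      prod.swap ` (SIGMA y:{- int m..int m}. grid_row S y \<inter> {- int m..int m})"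
    by (force simp: Q_box_eq grid_row_def)
  then show ?thesis
    by (simp add: card_image)
qed

lemma Q_box_discrepancy:
  assumes row_discrepancy:
    "\<And>y. \<bar>real (card (grid_row S y \<inter> {- int m..int m})) - \<delta> * real (2 * m + 1)\<bar> \<le> K"
  shows "\<bar>real (card (S \<inter> Q_box m)) / real (card (Q_box m)) - \<delta>\<bar> \<le> K / real (2 * m + 1)"
proof -
  define L where "L = real (2 * m + 1)"
  have "L > 0"
    by (simp add: L_def)
  have card_box: "real (card (Q_box m)) = L * L"
    by (simp only: card_Q_box of_nat_mult L_def)
  have "real (card (S \<inter> Q_box m)) - \<delta> * (L * L) =
      (\<Sum>y = - int m..int m. real (card (grid_row S y \<inter> {- int m..int m})) - \<delta> * L)"
    by (simp add: card_Int_Q_box sum_subtractf L_def algebra_simps)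
  also have "\<bar>\<dots>\<bar> \<le> (\<Sum>y = - int m..int m. K)"
    using row_discrepancy unfolding L_def by (intro sum_abs[THEN order_trans] sum_mono)
  also have "\<dots> = L * K"
    by (simp add: L_def)
  finally have total: "\<bar>real (card (S \<inter> Q_box m)) - \<delta> * (L * L)\<bar> \<le> L * K" .
  have "real (card (S \<inter> Q_box m)) / (L * L) - \<delta> =
      (real (card (S \<inter> Q_box m)) - \<delta> * (L * L)) / (L * L)"
    using \<open>L > 0\<close> by (simp add: diff_divide_distrib)
  also have "\<bar>\<dots>\<bar> = \<bar>real (card (S \<inter> Q_box m)) - \<delta> * (L * L)\<bar> / (L * L)"
    by simp
  also have "\<dots> \<le> L * K / (L * L)"
    using total by (rule divide_right_mono) simp
  also have "\<dots> = K / L"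
    using \<open>L > 0\<close> by simp
  finally show ?thesis
    unfolding card_box L_def .
qed

lemma grid_density_eqI:
  assumes row_discrepancy:
    "\<And>m y. \<bar>real (card (grid_row S y \<inter> {- int m..int m})) - \<delta> * real (2 * m + 1)\<bar> \<le> K"
  shows "grid_density S = ereal \<delta>"
proof -
  let ?\<rho> = "\<lambda>m. real (card (S \<inter> Q_box m)) / real (card (Q_box m))"
  have bound: "norm (?\<rho> m - \<delta>) \<le> norm (inverse (real (Suc (2 * m)))) * K" for m
    using Q_box_discrepancy[OF row_discrepancy, of m] by (simp add: field_simps)
  have null: "(\<lambda>m. inverse (real (Suc (2 * m)))) \<longlonglongrightarrow> 0"
    using LIMSEQ_subseq_LIMSEQ[OF LIMSEQ_inverse_real_of_nat, of "\<lambda>m. 2 * m"]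
    by (simp add: strict_mono_def o_def)
  have "(\<lambda>m. ?\<rho> m - \<delta>) \<longlonglongrightarrow> 0"
    by (rule tendsto_0_le[OF null]) (rule always_eventually, rule allI, rule bound)
  then have "(\<lambda>m. ereal (?\<rho> m)) \<longlonglongrightarrow> ereal \<delta>"
    by (simp add: LIM_zero_iff)
  then show ?thesis
    unfolding grid_density_def by (intro lim_imp_Limsup) simp_all
qed

lemma card_Int_multiple_window:
  assumes window: "\<And>a. card (P \<inter> {a..<a + int n}) = k"
  shows "card (P \<inter> {a..<a + int (q * n)}) = q * k"
proof (induction q)
  case 0
  show ?case by simp
next
  case (Suc q)
  let ?b = "a + int (q * n)"
  have "{a..<a + int (Suc q * n)} = {a..<?b} \<union> {?b..<?b + int n}"
    by (subst ivl_disj_un_two(3)) (simp_all add: algebra_simps)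
  then have "P \<inter> {a..<a + int (Suc q * n)} = (P \<inter> {a..<?b}) \<union> (P \<inter> {?b..<?b + int n})"
    by blast
  moreover have "card \<dots> = card (P \<inter> {a..<?b}) + card (P \<inter> {?b..<?b + int n})"
    by (intro card_Un_disjoint) auto
  ultimately show ?case
    using Suc.IH window by simp
qed

lemma card_Int_interval_discrepancy:
  assumes "0 < n" and window: "\<And>a. card (P \<inter> {a..<a + int n}) = k"
  shows "\<bar>real (card (P \<inter> {a..<a + int N})) - real k / real n * real N\<bar> \<le> real k"
proof -
  define q where "q = N div n"
  have N: "q * n \<le> N" "N \<le> Suc q * n"
    using assms(1) dividend_less_div_times[of n N] by (auto simp: q_def)
  have "card (P \<inter> {a..<a + int (q * n)}) \<le> card (P \<inter> {a..<a + int N})"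
    "card (P \<inter> {a..<a + int N}) \<le> card (P \<inter> {a..<a + int (Suc q * n)})"
    using N by (auto intro!: card_mono simp del: of_nat_mult mult_Suc)
  then have "real (q * k) \<le> real (card (P \<inter> {a..<a + int N}))"
    "real (card (P \<inter> {a..<a + int N})) \<le> real (Suc q * k)"
    unfolding card_Int_multiple_window[OF window] of_nat_le_iff .
  moreover have "real (q * k) \<le> real k / real n * real N"
    "real k / real n * real N \<le> real (Suc q * k)"
  proof -
    have "real (q * n) * real k \<le> real N * real k" "real N * real k \<le> real (Suc q * n) * real k"
      using N by (intro mult_right_mono; simp only: of_nat_le_iff of_nat_0_le_iff)+
    then show "real (q * k) \<le> real k / real n * real N"
      "real k / real n * real N \<le> real (Suc q * k)"
      using assms(1) by (simp_all add: field_simps)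
  qed
  ultimately show ?thesis
    by (simp add: abs_le_iff algebra_simps)
qed

lemma grid_density_eq_window_density:
  assumes "0 < n" and "\<And>a y. card (grid_row S y \<inter> {a..<a + int n}) = k"
  shows "grid_density S = ereal (real k / real n)"
proof (rule grid_density_eqI)
  fix m y
  have "{- int m..int m} = {- int m..<- int m + int (2 * m + 1)}"
    by auto
  then show "\<bar>real (card (grid_row S y \<inter> {- int m..int m})) - real k / real n * real (2 * m + 1)\<bar>
      \<le> real k"
    using card_Int_interval_discrepancy[OF assms] by presburger
qed

lemma card_shifted_residues:
  fixes a b :: int
  assumes "0 < n" "C \<subseteq> {0..<int n}"
  shows "card ({x. (x + b) mod int n \<in> C} \<inter> {a..<a + int n}) = card C"
proof (rule bij_betw_same_card)
  let ?g = "\<lambda>u. (u - (b + a)) mod int n + a"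
  have "?g ((x + b) mod int n) = x" if "x \<in> {a..<a + int n}" for x
    using that by (simp add: mod_simps)
  moreover have "(?g u + b) mod int n = u" if "u \<in> C" for u
    using that assms(2) by (auto simp: mod_simps add.assoc add.commute[of a b])
  ultimately show "bij_betw (\<lambda>x. (x + b) mod int n)
      ({x. (x + b) mod int n \<in> C} \<inter> {a..<a + int n}) C"
    using assms(1) by (intro bij_betw_byWitness[where f' = ?g]) auto
qed

lemma grid_density_vimage_grid_residue:
  assumes "0 < n" "C \<subseteq> {0..<int n}"
  shows "grid_density (grid_residue n c -` C) = ereal (real (card C) / real n)"
proof (rule grid_density_eq_window_density[OF assms(1)])
  fix a y
  have "grid_row (grid_residue n c -` C) y = {x. (x + int c * y) mod int n \<in> C}"
    by (simp add: grid_row_def grid_residue_def grid_form_def)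
  then show "card (grid_row (grid_residue n c -` C) y \<inter> {a..<a + int n}) = card C"
    using card_shifted_residues[OF assms] by simp
qed

theorem theorem2:
  fixes n d k :: nat
  assumes "0 < n" and "0 < k" and "3 \<le> d" and "real d \<le> real n / 2"
  shows "(\<forall>C. identifying_code (circulant_graph n {1, d - 1, d}) C \<and> card C = k \<longrightarrow>
            (\<exists>C'. identifying_code triangular_grid C' \<and>
                  grid_density C' = ereal (real k / real n))) \<and>
         (\<forall>C. locating_dominating_code (circulant_graph n {1, d - 1, d}) C \<and> card C = k \<longrightarrow>
            (\<exists>C'. locating_dominating_code triangular_grid C' \<and>
                  grid_density C' = ereal (real k / real n))) \<and>
         (\<forall>C. self_identifying_code (circulant_graph n {1, d - 1, d}) C \<and> card C = k \<longrightarrow>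
            (\<exists>C'. self_identifying_code triangular_grid C' \<and>
                  grid_density C' = ereal (real k / real n)))"
proof -
  obtain c where d: "d = Suc c"
    using assms(3) by (cases d) auto
  let ?H = "circulant_graph n {1, d - 1, d}"
  interpret separating_nbhd_projection triangular_grid ?H "grid_residue n c"
    using separating_nbhd_projection_grid_residue[of c n] assms(3,4) by (simp add: d)
  have density: "grid_density (lift C) = ereal (real (card C) / real n)" if "code ?H C" for C
  proof -
    have "lift C = grid_residue n c -` C"
      by (auto simp: lift_def verts_triangular_grid)
    then show ?thesis
      using that grid_density_vimage_grid_residue[OF assms(1)]
      by (simp add: code_def verts_circulant_graph)
  qed
  show ?thesis
    using identifying_code_lift locating_dominating_code_lift self_identifying_code_lift density
    unfolding identifying_code_def[of ?H] locating_dominating_code_def[of ?H]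
      dominating_code_def[of ?H] self_identifying_code_def[of ?H]
    by blast
qed

end
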